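(* Let $(X,\|\cdot,\dots,\cdot\|)$ be an $n$-normed space, let $Y=\{y_1,\dots,y_n\}\subset X$ be a fixed linearly independent set, let $m\in\{1,\dots,n\}$, and let $K\subset X$ be nonempty, closed and bounded. Suppose that $X$ is complete with respect to the norms of class-$m$ collection. If $T:K\to K$ is a contractive mapping with respect to the norms of class-$m$ collection, then $T$ has a unique fixed point.
   Context: Let $n$ be a positive integer and $X$ a real vector space with $\dim X\ge n$. An $n$-norm on $X$ is a map $\|\cdot,\dots,\cdot\|:X^n\to\mathbb{R}$ such that (i) $\|x_1,\dots,x_n\|\ge 0$, with equality if and only if $x_1,\dots,x_n$ are linearly dependent; (ii) it is invariant under permutations of its arguments; (iii) $\|\alpha x_1,x_2,\dots,x_n\|=|\alpha|\,\|x_1,\dots,x_n\|$ for $\alpha\in\mathbb{R}$; (iv) $\|x_1+x_1',x_2,\dots,x_n\|\le\|x_1,x_2,\dots,x_n\|+\|x_1',x_2,\dots,x_n\|$. The pair $(X,\|\cdot,\dots,\cdot\|)$ is called an $n$-normed space. Fix a linearly independent set $Y=\{y_1,\dots,y_n\}\subset X$. For $m\in\{1,\dots,n\}$ and an $m$-element subset $\{i_1,\dots,i_m\}\subset\{1,\dots,n\}$, let $Y^0_{i_1,\dots,i_m}=\mathrm{span}\{y_i: i\notin\{i_1,\dots,i_m\}\}$, let $X^*_{i_1,\dots,i_m}=X/Y^0_{i_1,\dots,i_m}$, let $\overline{u}$ denote the coset of $u\in X$, and define the norm $$\|\overline{u}\|^*_{i_1,\dots,i_m}=\sum_{j=1}^m\|u,y_1,\dots,y_{i_j-1},y_{i_j+1},\dots,y_n\|$$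 on $X^*_{i_1,\dots,i_m}$. The set of these $\binom{n}{m}$ quotient spaces is the class-$m$ collection, and their norms are "the norms of class-$m$ collection". A sequence $\{x_k\}$ in $X$ converges to $x\in X$ with respect to the norms of class-$m$ collection if for every $\epsilon>0$ there is $N\in\mathbb{N}$ such that $\|\overline{x_k-x}\|^*_{i_1,\dots,i_m}<\epsilon$ for all $k\ge N$ and every $m$-element subset $\{i_1,\dots,i_m\}\subset\{1,\dots,n\}$. It is Cauchy if for every $\epsilon>0$ there is $N$ such that $\|\overline{x_k-x_l}\|^*_{i_1,\dots,i_m}<\epsilon$ for all $k,l\ge N$ and every such subset. $X$ is complete if every Cauchy sequence in $X$ converges to an element of $X$. A set $K\subseteq X$ is closed if the limit of any sequence in $K$ that converges in $X$ belongs to $K$. A nonempty $K$ is bounded if there is $M>0$ such that $\|\overline{x}\|^*_{i_1,\dots,i_m}\le M$ for every $x\in K$ and every such subset. (These notions are independent of the choice of $m$; here they may be taken with respect to the norms of class-$m$ collection.) A mapping $T:K\to K$ is contractive with respect to the norms of class-$m$ collection if there is $C\in(0,1)$ such that for all $x,y\in K$, $\|\overline{Tx-Ty}\|^*_{i_1,\dots,i_m}\le C\,\|\overline{x-y}\|^*_{i_1,\dots,i_m}$ for every $m$-element subset $\{i_1,\dots,i_m\}\subset\{1,\dots,n\}$. *)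

theory Defs
  imports Complex_Main "HOL-Library.Multiset" "HOL-Library.Set_Algebras" "HOL-Library.FuncSet"
begin

text \<open>
  The space \<open>X\<close> is the whole type \<open>'a\<close>, and an element of \<open>X ^ n\<close> is a list of length \<open>n\<close>.
  The value of \<open>nrm\<close> on lists of any other length is irrelevant. A tuple with a repeated entry is
  linearly dependent, which the library predicate on the set of its entries does not see; hence
  \<open>distinct\<close>. Since \<open>X\<close> may be infinite-dimensional, \<open>dim X \<ge> n\<close> is expressed by the existence of
  \<open>n\<close> linearly independent vectors.
\<close>

locale n_normed_space =
  fixes n :: nat and nrm :: "'a::real_vector list \<Rightarrow> real"
  assumes n_pos: "0 < n"
    and dim_ge: "\<exists>B :: 'a set. independent B \<and> card B = n"
    and nrm_nonneg: "length xs = n \<Longrightarrow> 0 \<le> nrm xs"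
    and nrm_eq_0_iff: "length xs = n \<Longrightarrow> nrm xs = 0 \<longleftrightarrow> \<not> distinct xs \<or> dependent (set xs)"
    and nrm_perm: "length xs = n \<Longrightarrow> mset xs' = mset xs \<Longrightarrow> nrm xs' = nrm xs"
    and nrm_scale: "length (x # xs) = n \<Longrightarrow> nrm ((a *\<^sub>R x) # xs) = \<bar>a\<bar> * nrm (x # xs)"
    and nrm_triangle: "length (x # xs) = n \<Longrightarrow>
      nrm ((x + x') # xs) \<le> nrm (x # xs) + nrm (x' # xs)"

definition class_index :: "nat \<Rightarrow> nat \<Rightarrow> nat set set" where
  "class_index n m = {I. I \<subseteq> {1..n} \<and> card I = m}"

definition Y0 :: "nat \<Rightarrow> (nat \<Rightarrow> 'a::real_vector) \<Rightarrow> nat set \<Rightarrow> 'a set" where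
  "Y0 n y I = span (y ` ({1..n} - I))"

definition qcoset :: "nat \<Rightarrow> (nat \<Rightarrow> 'a::real_vector) \<Rightarrow> nat set \<Rightarrow> 'a \<Rightarrow> 'a set" where
  "qcoset n y I u = u +o Y0 n y I"

definition rep_norm ::
  "nat \<Rightarrow> ('a::real_vector list \<Rightarrow> real) \<Rightarrow> (nat \<Rightarrow> 'a) \<Rightarrow> nat set \<Rightarrow> 'a \<Rightarrow> real" where
  "rep_norm n nrm y I u = (\<Sum>j\<in>I. nrm (u # map y (filter (\<lambda>i. i \<noteq> j) [1..<Suc n])))"

text \<open>
  The norm on the quotient takes a coset as argument and evaluates the defining formula at a chosen
  representative; the lemma \<open>quotient_norm_qcoset\<close> below shows that the choice does not matter.
\<close>

definition quotient_norm ::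
  "nat \<Rightarrow> ('a::real_vector list \<Rightarrow> real) \<Rightarrow> (nat \<Rightarrow> 'a) \<Rightarrow> nat set \<Rightarrow> 'a set \<Rightarrow> real" where
  "quotient_norm n nrm y I U = rep_norm n nrm y I (SOME u. u \<in> U)"

definition class_converges ::
  "nat \<Rightarrow> ('a::real_vector list \<Rightarrow> real) \<Rightarrow> (nat \<Rightarrow> 'a) \<Rightarrow> nat \<Rightarrow> (nat \<Rightarrow> 'a) \<Rightarrow> 'a \<Rightarrow> bool" where
  "class_converges n nrm y m s x \<longleftrightarrow>
    (\<forall>\<epsilon>>0. \<exists>N. \<forall>k\<ge>N. \<forall>I\<in>class_index n m.
      quotient_norm n nrm y I (qcoset n y I (s k - x)) < \<epsilon>)"

definition class_Cauchy ::
  "nat \<Rightarrow> ('a::real_vector list \<Rightarrow> real) \<Rightarrow> (nat \<Rightarrow> 'a) \<Rightarrow> nat \<Rightarrow> (nat \<Rightarrow> 'a) \<Rightarrow> bool" where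
  "class_Cauchy n nrm y m s \<longleftrightarrow>
    (\<forall>\<epsilon>>0. \<exists>N. \<forall>k\<ge>N. \<forall>l\<ge>N. \<forall>I\<in>class_index n m.
      quotient_norm n nrm y I (qcoset n y I (s k - s l)) < \<epsilon>)"

definition class_complete ::
  "nat \<Rightarrow> ('a::real_vector list \<Rightarrow> real) \<Rightarrow> (nat \<Rightarrow> 'a) \<Rightarrow> nat \<Rightarrow> bool" where
  "class_complete n nrm y m \<longleftrightarrow>
    (\<forall>s. class_Cauchy n nrm y m s \<longrightarrow> (\<exists>x. class_converges n nrm y m s x))"

definition class_closed ::
  "nat \<Rightarrow> ('a::real_vector list \<Rightarrow> real) \<Rightarrow> (nat \<Rightarrow> 'a) \<Rightarrow> nat \<Rightarrow> 'a set \<Rightarrow> bool" where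
  "class_closed n nrm y m K \<longleftrightarrow>
    (\<forall>s x. (\<forall>k. s k \<in> K) \<and> class_converges n nrm y m s x \<longrightarrow> x \<in> K)"

definition class_bounded ::
  "nat \<Rightarrow> ('a::real_vector list \<Rightarrow> real) \<Rightarrow> (nat \<Rightarrow> 'a) \<Rightarrow> nat \<Rightarrow> 'a set \<Rightarrow> bool" where
  "class_bounded n nrm y m K \<longleftrightarrow>
    (\<exists>M>0. \<forall>x\<in>K. \<forall>I\<in>class_index n m. quotient_norm n nrm y I (qcoset n y I x) \<le> M)"

definition class_contractive ::
  "nat \<Rightarrow> ('a::real_vector list \<Rightarrow> real) \<Rightarrow> (nat \<Rightarrow> 'a) \<Rightarrow> nat \<Rightarrow> 'a set \<Rightarrow> ('a \<Rightarrow> 'a) \<Rightarrow> bool" where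
  "class_contractive n nrm y m K T \<longleftrightarrow>
    (\<exists>C. 0 < C \<and> C < 1 \<and> (\<forall>x\<in>K. \<forall>x'\<in>K. \<forall>I\<in>class_index n m.
      quotient_norm n nrm y I (qcoset n y I (T x - T x'))
        \<le> C * quotient_norm n nrm y I (qcoset n y I (x - x'))))"

context n_normed_space
begin

lemma nrm_add_span:
  assumes len: "length (u # xs) = n" and w: "w \<in> span (set xs)"
  shows "nrm ((u + w) # xs) = nrm (u # xs)"
proof -
  have zero: "nrm (v # xs) = 0" if v: "v \<in> span (set xs)" for v
  proof -
    have "\<not> distinct (v # xs) \<or> dependent (set (v # xs))"
      using v by (auto simp: independent_insert split: if_splits)
    moreover have "length (v # xs) = n" using len by simp
    ultimately show ?thesis by (simp only: nrm_eq_0_iff)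
  qed
  have "nrm ((u + w) # xs) \<le> nrm (u # xs)"
    using nrm_triangle[of u xs w] zero[OF w] len by simp
  moreover have "nrm (u # xs) \<le> nrm ((u + w) # xs)"
    using nrm_triangle[of "u + w" xs "- w"] zero[of "- w"] w len by (simp add: span_neg)
  ultimately show ?thesis by simp
qed

lemma length_filter_neq:
  assumes "j \<in> {1..n}"
  shows "length (filter (\<lambda>i. i \<noteq> j) [1..<Suc n]) = n - 1"
proof -
  have "length (filter (\<lambda>i. i \<noteq> j) [1..<Suc n]) = card (set (filter (\<lambda>i. i \<noteq> j) [1..<Suc n]))"
    by (intro distinct_card[symmetric]) simp
  also have "set (filter (\<lambda>i. i \<noteq> j) [1..<Suc n]) = {1..n} - {j}" by auto
  finally show ?thesis using assms by simp
qed

lemma rep_norm_add_Y0: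
  assumes I: "I \<subseteq> {1..n}" and w: "w \<in> Y0 n y I"
  shows "rep_norm n nrm y I (u + w) = rep_norm n nrm y I u"
  unfolding rep_norm_def
proof (rule sum.cong[OF refl])
  fix j assume j: "j \<in> I"
  let ?xs = "map y (filter (\<lambda>i. i \<noteq> j) [1..<Suc n])"
  have "y ` ({1..n} - I) \<subseteq> set ?xs" using j by auto
  then have "w \<in> span (set ?xs)" using w span_mono unfolding Y0_def by blast
  moreover have "length (u # ?xs) = n"
    using length_filter_neq[of j] I j n_pos by (auto simp del: upt_Suc)
  ultimately show "nrm ((u + w) # ?xs) = nrm (u # ?xs)" by (rule nrm_add_span[rotated])
qed

lemma quotient_norm_qcoset:
  assumes "I \<subseteq> {1..n}"
  shows "quotient_norm n nrm y I (qcoset n y I u) = rep_norm n nrm y I u"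
proof -
  have "u \<in> qcoset n y I u"
    unfolding qcoset_def elt_set_plus_def Y0_def using span_zero by force
  then have "(SOME v. v \<in> qcoset n y I u) \<in> qcoset n y I u" by (rule someI)
  then obtain w where "w \<in> Y0 n y I" "(SOME v. v \<in> qcoset n y I u) = u + w"
    unfolding qcoset_def elt_set_plus_def by auto
  then show ?thesis unfolding quotient_norm_def using rep_norm_add_Y0[OF assms] by simp
qed

end

end

theory Submission imports Defs begin

text \<open>
  The class-\<open>m\<close> quotient norms pull back to finitely many seminorms on \<open>X\<close>. A vector on which all of
  them vanish lies in the span of \<open>Y - {y\<^sub>j}\<close> for every \<open>j\<close>, so it is zero because \<open>Y\<close> is linearly
  independent. The contraction principle then runs in every seminorm simultaneously: boundedness of
  \<open>K\<close> gives \<open>p (T\<^sup>k x - T\<^sup>l x) \<le> 2 M C\<^sup>k\<close> for \<open>k \<le> l\<close>, so the orbit of any point is Cauchy, and its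
  limit is a fixed point.
\<close>

text \<open>Coordinates with respect to an independent set are unique, so an expansion of
  \<open>u\<close> over \<open>B - {b}\<close> is also its expansion over \<open>B\<close>. Hence
  the coordinate of \<open>u\<close> at each \<open>b\<close> is zero.\<close>

lemma (in vector_space) independent_span_remove_eq_0:
  assumes B: "independent B" and u: "u \<in> span B"
    and rem: "\<And>b. b \<in> B \<Longrightarrow> u \<in> span (B - {b})"
  shows "u = 0"
proof -
  have "representation B u b = 0" for b
  proof (cases "b \<in> B")
    case True
    have "representation B u = representation (B - {b}) u"
      using rem[OF True] by (intro representation_extend[OF B]) auto
    moreover have "representation (B - {b}) u b = 0"
      using representation_ne_zero[of "B - {b}" u b] by blast
    ultimately show ?thesis by simp
  next
    case False
    then show ?thesis using representation_ne_zero[of B u b] by blast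
  qed
  then show ?thesis using sum_nonzero_representation_eq[OF B u] by simp
qed

context n_normed_space
begin

lemma length_Cons_map_filter_neq:
  assumes "j \<in> {1..n}"
  shows "length (u # map y (filter (\<lambda>i. i \<noteq> j) [1..<Suc n])) = n"
  using length_filter_neq[OF assms] n_pos by (simp del: upt_Suc)

lemma rep_norm_nonneg:
  assumes "I \<subseteq> {1..n}"
  shows "0 \<le> rep_norm n nrm y I u"
  unfolding rep_norm_def
  using assms by (intro sum_nonneg nrm_nonneg length_Cons_map_filter_neq) auto

lemma rep_norm_triangle:
  assumes "I \<subseteq> {1..n}"
  shows "rep_norm n nrm y I (u + v) \<le> rep_norm n nrm y I u + rep_norm n nrm y I v"
  unfolding rep_norm_def sum.distrib[symmetric]
  using assms by (intro sum_mono nrm_triangle length_Cons_map_filter_neq) auto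

lemma rep_norm_minus:
  assumes "I \<subseteq> {1..n}"
  shows "rep_norm n nrm y I (- u) = rep_norm n nrm y I u"
  unfolding rep_norm_def
proof (rule sum.cong[OF refl])
  fix j assume "j \<in> I"
  then have "j \<in> {1..n}" using assms by auto
  from nrm_scale[OF length_Cons_map_filter_neq[OF this], of "- 1" u y]
  show "nrm (- u # map y (filter (\<lambda>i. i \<noteq> j) [1..<Suc n]))
    = nrm (u # map y (filter (\<lambda>i. i \<noteq> j) [1..<Suc n]))" by (simp del: upt_Suc)
qed

text \<open>Injectivity makes removal of the index \<open>j\<close> the same as removal of the
  vector \<open>y j\<close>. The remaining vectors are distinct and independent, so the degeneracy
  of the tuple can only come from \<open>u\<close>.\<close>

lemma nrm_remove_eq_0_imp_span:
  assumes inj: "inj_on y {1..n}" and ind: "independent (y ` {1..n})" and j: "j \<in> {1..n}"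
    and zero: "nrm (u # map y (filter (\<lambda>i. i \<noteq> j) [1..<Suc n])) = 0"
  shows "u \<in> span (y ` {1..n} - {y j})"
proof -
  let ?js = "filter (\<lambda>i. i \<noteq> j) [1..<Suc n]"
  let ?S = "y ` {1..n} - {y j}"
  have js: "set ?js = {1..n} - {j}" by auto
  have S: "set (map y ?js) = ?S"
    unfolding set_map js using inj_on_image_set_diff[OF inj, of "{1..n}" "{j}"] j by simp
  have dist: "distinct (map y ?js)"
    unfolding distinct_map js using inj by (simp add: inj_on_diff del: upt_Suc)
  have indS: "independent ?S" using ind by (rule independent_mono) auto
  \<comment> \<open>The first case is a repeated entry: since the tail is distinct, the repetition
    must involve \<open>u\<close>. In both cases \<open>u\<close> lies in the span of
    \<open>?S\<close>.\<close>
  have "u \<in> ?S \<or> dependent (insert u ?S)"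
    using zero dist unfolding nrm_eq_0_iff[OF length_Cons_map_filter_neq[OF j]]
      distinct.simps list.set(2) S by blast
  then show ?thesis using indS independent_insert[of u ?S] span_base[of u ?S] by metis
qed

text \<open>Every \<open>j\<close> belongs to some index set of size \<open>m\<close>. The sum over
  that set has nonnegative terms and vanishes, so its \<open>j\<close>-th term vanishes and
  \<open>u\<close> is in the span of the other basis vectors.\<close>

lemma rep_norm_all_eq_0_imp_eq_0:
  assumes inj: "inj_on y {1..n}" and ind: "independent (y ` {1..n})" and m: "m \<in> {1..n}"
    and zero: "\<And>I. I \<in> class_index n m \<Longrightarrow> rep_norm n nrm y I u = 0"
  shows "u = 0"
proof -
  have sp: "u \<in> span (y ` {1..n} - {y j})" if j: "j \<in> {1..n}" for j
  proof (rule nrm_remove_eq_0_imp_span[OF inj ind j])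
    have "m - 1 \<le> card ({1..n} - {j})" using m j by (simp add: diff_le_mono)
    then obtain J where J: "J \<subseteq> {1..n} - {j}" "card J = m - 1" "finite J"
      using obtain_subset_with_card_n by metis
    have "insert j J \<in> class_index n m"
      using J m j unfolding class_index_def by (auto simp: card_insert_if)
    from zero[OF this] have "rep_norm n nrm y (insert j J) u = 0" .
    moreover have "0 \<le> nrm (u # map y (filter (\<lambda>k. k \<noteq> i) [1..<Suc n]))" if "i \<in> insert j J" for i
      using that J(1) j by (intro nrm_nonneg length_Cons_map_filter_neq) auto
    moreover have "finite (insert j J)" "j \<in> insert j J" using J(3) by auto
    ultimately show "nrm (u # map y (filter (\<lambda>k. k \<noteq> j) [1..<Suc n])) = 0"
      unfolding rep_norm_def by (meson sum_nonneg_eq_0_iff)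
  qed
  \<comment> \<open>Any index would serve here; \<open>m\<close> is at hand as an element of
    \<open>{1..n}\<close>.\<close>
  have "u \<in> span (y ` {1..n})"
    using sp[OF m] span_mono[of "y ` {1..n} - {y m}" "y ` {1..n}"] by blast
  with ind show ?thesis
    by (rule real_vector.independent_span_remove_eq_0) (use sp in blast)
qed

end

lemma seminorm_family_contraction_unique_fixpoint:
  fixes p :: "'i \<Rightarrow> 'a::ab_group_add \<Rightarrow> real" and K :: "'a set" and T :: "'a \<Rightarrow> 'a"
  assumes nonneg: "\<And>i u. i \<in> A \<Longrightarrow> 0 \<le> p i u"
    and triangle: "\<And>i u v. i \<in> A \<Longrightarrow> p i (u + v) \<le> p i u + p i v"
    and minus: "\<And>i u. i \<in> A \<Longrightarrow> p i (- u) = p i u"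
    and separating: "\<And>u. (\<And>i. i \<in> A \<Longrightarrow> p i u = 0) \<Longrightarrow> u = 0"
    and complete: "\<And>s. \<forall>\<epsilon>>0. \<exists>N. \<forall>k\<ge>N. \<forall>l\<ge>N. \<forall>i\<in>A. p i (s k - s l) < \<epsilon>
      \<Longrightarrow> \<exists>x. \<forall>\<epsilon>>0. \<exists>N::nat. \<forall>k\<ge>N. \<forall>i\<in>A. p i (s k - x) < \<epsilon>"
    and closed: "\<And>s x. (\<And>k. s k \<in> K)
      \<Longrightarrow> \<forall>\<epsilon>>0. \<exists>N::nat. \<forall>k\<ge>N. \<forall>i\<in>A. p i (s k - x) < \<epsilon> \<Longrightarrow> x \<in> K"
    and bounded: "\<And>i x. i \<in> A \<Longrightarrow> x \<in> K \<Longrightarrow> p i x \<le> M"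
    and contractive: "\<And>i x x'. i \<in> A \<Longrightarrow> x \<in> K \<Longrightarrow> x' \<in> K \<Longrightarrow> p i (T x - T x') \<le> C * p i (x - x')"
    and C: "0 \<le> C" "C < 1" and maps: "T \<in> K \<rightarrow> K" and ne: "K \<noteq> {}"
  shows "\<exists>!x. x \<in> K \<and> T x = x"
proof -
  have commute: "p i (u - v) = p i (v - u)" if "i \<in> A" for i u v
    using minus[OF that, of "u - v"] by simp
  have diff: "p i (u - w) \<le> p i (u - v) + p i (v - w)" if "i \<in> A" for i u v w
    using triangle[OF that, of "u - v" "v - w"] by simp
  from ne obtain x0 where x0: "x0 \<in> K" by blast
  define s where "s k = (T ^^ k) x0" for k
  have s_Suc: "s (Suc k) = T (s k)" for k by (simp add: s_def)
  have sK: "s k \<in> K" for k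
    by (induction k) (use maps x0 in \<open>auto simp: s_Suc, simp add: s_def\<close>)
  have pdiff: "p i (x - x') \<le> 2 * M" if "i \<in> A" "x \<in> K" "x' \<in> K" for i x x'
    using triangle[OF that(1), of x "- x'"] minus[OF that(1), of x'] bounded[OF that(1,2)] bounded[OF that(1,3)] by simp
  \<comment> \<open>The start of the induction bounds the distance of any two points of
    \<open>K\<close> by \<open>2 * M\<close>. This bound is uniform in \<open>l\<close>, so the
    Cauchy property follows without summing a geometric series.\<close>
  have decay: "p i (s (k + l) - s k) \<le> C ^ k * (2 * M)" if i: "i \<in> A" for i k l
  proof (induction k)
    case 0
    show ?case using pdiff[OF i sK sK] by simp
  next
    case (Suc k)
    have "p i (s (Suc k + l) - s (Suc k)) \<le> C * p i (s (k + l) - s k)"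
      using contractive[OF i sK sK] by (simp add: s_Suc)
    also have "\<dots> \<le> C * (C ^ k * (2 * M))" using Suc C by (intro mult_left_mono) auto
    finally show ?case by (simp add: mult.assoc)
  qed
  have Cauchy: "\<forall>\<epsilon>>0. \<exists>N. \<forall>k\<ge>N. \<forall>l\<ge>N. \<forall>i\<in>A. p i (s k - s l) < \<epsilon>"
  proof (intro allI impI)
    fix \<epsilon> :: real assume "\<epsilon> > 0"
    have "(\<lambda>k. C ^ k * (2 * M)) \<longlonglongrightarrow> 0"
      using C by (intro tendsto_mult_left_zero LIMSEQ_power_zero) auto
    with \<open>\<epsilon> > 0\<close> have "\<forall>\<^sub>F k in sequentially. C ^ k * (2 * M) < \<epsilon> / 2"
      by (intro order_tendstoD(2)) auto
    then obtain N where N: "C ^ N * (2 * M) < \<epsilon> / 2" by (auto simp: eventually_sequentially)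
    \<comment> \<open>Both \<open>s k\<close> and \<open>s l\<close> are compared with
      \<open>s N\<close>; each comparison costs less than \<epsilon>/2.\<close>
    have "p i (s k - s l) < \<epsilon>" if "k \<ge> N" "l \<ge> N" "i \<in> A" for k l i
      using diff[OF that(3), of "s k" "s l" "s N"] commute[OF that(3), of "s N" "s l"] N
        decay[OF that(3), of N "k - N"] decay[OF that(3), of N "l - N"] that by simp
    then show "\<exists>N. \<forall>k\<ge>N. \<forall>l\<ge>N. \<forall>i\<in>A. p i (s k - s l) < \<epsilon>" by blast
  qed
  from complete[OF Cauchy] obtain x
    where lim: "\<forall>\<epsilon>>0. \<exists>N. \<forall>k\<ge>N. \<forall>i\<in>A. p i (s k - x) < \<epsilon>" by blast
  have xK: "x \<in> K" using closed[OF sK lim] .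
  have "p i (T x - x) = 0" if i: "i \<in> A" for i
  proof -
    \<comment> \<open>The intermediate point is \<open>s (Suc N) = T (s N)\<close>: contraction
      brings it close to \<open>T x\<close>, and convergence brings it close to
      \<open>x\<close>.\<close>
    have "p i (T x - x) \<le> 0 + \<epsilon>" if "\<epsilon> > 0" for \<epsilon>
    proof -
      from lim that obtain N where N: "\<And>k. k \<ge> N \<Longrightarrow> p i (s k - x) < \<epsilon> / 2"
        using i half_gt_zero by metis
      have "p i (T x - T (s N)) \<le> C * p i (s N - x)"
        using contractive[OF i xK sK, of N] commute[OF i, of x "s N"] by simp
      also have "\<dots> \<le> p i (s N - x)" using C nonneg[OF i] by (intro mult_left_le_one_le) auto
      finally show ?thesis
        using diff[OF i, of "T x" x "s (Suc N)"] N[of N] N[of "Suc N"] by (simp add: s_Suc)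
    qed
    then have "p i (T x - x) \<le> 0" by (rule field_le_epsilon)
    with nonneg[OF i] show ?thesis by (simp add: order_antisym)
  qed
  then have Tx: "T x = x" using separating[of "T x - x"] by simp
  have "x' = x" if x': "x' \<in> K" "T x' = x'" for x'
  proof -
    have "p i (x' - x) = 0" if i: "i \<in> A" for i
    proof -
      \<comment> \<open>For two fixed points the contraction inequality bounds
        \<open>p i (x' - x)\<close> by \<open>C\<close> times itself.\<close>
      have "(1 - C) * p i (x' - x) \<le> 0"
        using contractive[OF i x'(1) xK] x'(2) Tx by (simp add: algebra_simps)
      then show ?thesis using C nonneg[OF i, of "x' - x"] by (simp add: mult_le_0_iff)
    qed
    then show ?thesis using separating[of "x' - x"] by simp
  qed
  with xK Tx show ?thesis by blast
qed

theorem theorem4p5: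
  fixes n m :: nat
    and nrm :: "'a::real_vector list \<Rightarrow> real"
    and y :: "nat \<Rightarrow> 'a"
    and K :: "'a set"
    and T :: "'a \<Rightarrow> 'a"
  assumes "n_normed_space n nrm"
    and "inj_on y {1..n}" and "independent (y ` {1..n})"
    and "m \<in> {1..n}"
    and "K \<noteq> {}"
    and "class_closed n nrm y m K"
    and "class_bounded n nrm y m K"
    and "class_complete n nrm y m"
    and "T \<in> K \<rightarrow> K"
    and "class_contractive n nrm y m K T"
  shows "\<exists>!x. x \<in> K \<and> T x = x"
proof -
  interpret n_normed_space n nrm by fact
  have sub: "I \<subseteq> {1..n}" if "I \<in> class_index n m" for I
    using that by (simp add: class_index_def)
  \<comment> \<open>Independence of the representative turns each class notion into a statement
    about \<open>rep_norm\<close> on the space itself.\<close>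
  have q: "quotient_norm n nrm y I (qcoset n y I u) = rep_norm n nrm y I u"
    if "I \<in> class_index n m" for I u
    using quotient_norm_qcoset[OF sub[OF that]] .
  from assms(7) obtain M where M: "\<And>x I. x \<in> K \<Longrightarrow> I \<in> class_index n m \<Longrightarrow> rep_norm n nrm y I x \<le> M"
    unfolding class_bounded_def by (auto simp: q)
  from assms(10) obtain C where C: "0 < C" "C < 1"
    "\<And>x x' I. x \<in> K \<Longrightarrow> x' \<in> K \<Longrightarrow> I \<in> class_index n m \<Longrightarrow>
      rep_norm n nrm y I (T x - T x') \<le> C * rep_norm n nrm y I (x - x')"
    unfolding class_contractive_def by (auto simp: q)
  have conv: "class_converges n nrm y m s x \<longleftrightarrow>
    (\<forall>\<epsilon>>0. \<exists>N. \<forall>k\<ge>N. \<forall>I\<in>class_index n m. rep_norm n nrm y I (s k - x) < \<epsilon>)" for s x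
    by (simp add: class_converges_def q)
  have Cauchy: "class_Cauchy n nrm y m s \<longleftrightarrow>
    (\<forall>\<epsilon>>0. \<exists>N. \<forall>k\<ge>N. \<forall>l\<ge>N. \<forall>I\<in>class_index n m. rep_norm n nrm y I (s k - s l) < \<epsilon>)" for s
    by (simp add: class_Cauchy_def q)
  show ?thesis
  proof (rule seminorm_family_contraction_unique_fixpoint
      [where A = "class_index n m" and p = "rep_norm n nrm y" and M = M and C = C])
    show "u = 0" if "\<And>I. I \<in> class_index n m \<Longrightarrow> rep_norm n nrm y I u = 0" for u
      using rep_norm_all_eq_0_imp_eq_0[OF assms(2,3,4) that] .
    show "\<exists>x. \<forall>\<epsilon>>0. \<exists>N::nat. \<forall>k\<ge>N. \<forall>I\<in>class_index n m. rep_norm n nrm y I (s k - x) < \<epsilon>"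
      if "\<forall>\<epsilon>>0. \<exists>N. \<forall>k\<ge>N. \<forall>l\<ge>N. \<forall>I\<in>class_index n m. rep_norm n nrm y I (s k - s l) < \<epsilon>" for s
      using assms(8) that unfolding class_complete_def conv Cauchy by blast
    show "x \<in> K" if "\<And>k. s k \<in> K"
      "\<forall>\<epsilon>>0. \<exists>N::nat. \<forall>k\<ge>N. \<forall>I\<in>class_index n m. rep_norm n nrm y I (s k - x) < \<epsilon>" for s x
      using assms(6) that unfolding class_closed_def conv by blast
  qed (use rep_norm_nonneg[OF sub] rep_norm_triangle[OF sub] rep_norm_minus[OF sub] M C assms(5,9)
      in simp_all)
qed

end
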